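(* Let $n\geq 3$ be an even integer and let $k$ be an integer with $1\leq k<n/2$. The generalized Tutte-Coxeter graph $TC(n,k)$ is vertex-transitive if and only if $(n,k)=(10,3)$.
   Context: For an even integer $n\geq 3$ and an integer $1\leq k<n/2$, the generalized Tutte-Coxeter graph $TC(n,k)$ is the graph on the $3n$ vertices $a_0,\ldots,a_{n-1},b_0,\ldots,b_{n-1},c_0,\ldots,c_{n-1}$ whose edges are $\{a_i,a_{i+1}\}$, $\{a_i,b_i\}$, $\{b_i,b_{i+n/2}\}$, $\{b_i,c_i\}$ and $\{c_i,c_{i+k}\}$ for all $i$, with all indices taken modulo $n$. A graph is vertex-transitive if its automorphism group acts transitively on its vertices. *)

theory Defs
  imports "Graph_Theory.Graph_Theory"
begin

text \<open>
  Graphs are symmetric digraphs, as in the entry \<open>Graph_Theory\<close>; an undirected edge corresponds to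
  the two arcs joining its ends. An automorphism is an isomorphism of the graph onto itself. For a
  graph whose arcs are pairs it amounts to a permutation of the vertices that preserves adjacency
  and non-adjacency, see \<open>graph_automorphism_with_proj_iff\<close> below.
\<close>

definition graph_automorphism ::
    "('a, 'b) pre_digraph \<Rightarrow> ('a, 'b, 'a, 'b) digraph_isomorphism \<Rightarrow> bool" where
  "graph_automorphism G h \<longleftrightarrow> pre_digraph.digraph_isomorphism G h \<and> app_iso h G = G"

definition vertex_transitive :: "('a, 'b) pre_digraph \<Rightarrow> bool" where
  "vertex_transitive G \<longleftrightarrow>
     (\<forall>u \<in> verts G. \<forall>v \<in> verts G. \<exists>h. graph_automorphism G h \<and> iso_verts h u = v)"

datatype tc_vertex = Va nat | Vb nat | Vc nat

text \<open>
  Each edge of the graph is listed here in some orientation (the edges \<open>{b\<^sub>i, b\<^bsub>i+n/2\<^esub>}\<close> in both);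
  \<open>TC\<close> is the symmetric closure.
\<close>

definition TC_oriented :: "nat \<Rightarrow> nat \<Rightarrow> tc_vertex pair_pre_digraph" where
  "TC_oriented n k =
     \<lparr> pverts = Va ` {..<n} \<union> Vb ` {..<n} \<union> Vc ` {..<n},
       parcs = (\<Union>i<n. {(Va i, Va ((i + 1) mod n)),
                        (Va i, Vb i),
                        (Vb i, Vb ((i + n div 2) mod n)),
                        (Vb i, Vc i),
                        (Vc i, Vc ((i + k) mod n))}) \<rparr>"

definition TC :: "nat \<Rightarrow> nat \<Rightarrow> tc_vertex pair_pre_digraph" where
  "TC n k = mk_symmetric (with_proj (TC_oriented n k))"

lemma graph_automorphism_with_proj_iff:
  assumes "pair_wf_digraph G"
  shows "(\<exists>h. graph_automorphism (with_proj G) h \<and> (\<forall>v \<in> pverts G. iso_verts h v = f v)) \<longleftrightarrow>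
    bij_betw f (pverts G) (pverts G) \<and>
    (\<forall>u \<in> pverts G. \<forall>v \<in> pverts G. (f u, f v) \<in> parcs G \<longleftrightarrow> (u, v) \<in> parcs G)"
    (is "?L \<longleftrightarrow> ?R")
proof -
  interpret pair_wf_digraph G by fact
  show ?thesis
  proof
    assume ?L
    then obtain h where h: "pre_digraph.digraph_isomorphism (with_proj G) h"
        "app_iso h (with_proj G) = with_proj G" and hf: "\<And>v. v \<in> pverts G \<Longrightarrow> iso_verts h v = f v"
      by (auto simp: graph_automorphism_def)
    from arg_cong[OF h(2), of tail] arg_cong[OF h(2), of head]
    have ht: "iso_tail h = fst" "iso_head h = snd" by auto
    from arg_cong[OF h(2), of verts] arg_cong[OF h(2), of arcs]
    have im: "iso_verts h ` pverts G = pverts G" "iso_arcs h ` parcs G = parcs G" by auto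
    have inj: "inj_on (iso_verts h) (pverts G)"
      using h(1) by (simp add: pre_digraph.digraph_isomorphism_def)
    have arc: "iso_arcs h (u, v) = (f u, f v)" if "(u, v) \<in> parcs G" for u v
    proof -
      have "fst (iso_arcs h (u, v)) = iso_verts h u" "snd (iso_arcs h (u, v)) = iso_verts h v"
        using h(1) that ht by (auto simp: pre_digraph.digraph_isomorphism_def)
      then show ?thesis using hf in_arcsD1[OF that] in_arcsD2[OF that] by (metis prod.collapse)
    qed
    have bij: "bij_betw f (pverts G) (pverts G)"
      using inj im(1) hf by (metis bij_betw_cong bij_betw_imageI)
    moreover have "(f u, f v) \<in> parcs G \<longleftrightarrow> (u, v) \<in> parcs G"
      if uv: "u \<in> pverts G" "v \<in> pverts G" for u v
    proof
      assume "(u, v) \<in> parcs G"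
      then show "(f u, f v) \<in> parcs G" using arc im(2) by (metis imageI)
    next
      assume "(f u, f v) \<in> parcs G"
      then obtain x y where xy: "(x, y) \<in> parcs G" "iso_arcs h (x, y) = (f u, f v)"
        using im(2) by (metis imageE surj_pair)
      then have "f x = f u" "f y = f v" using arc by auto
      then have "x = u" "y = v"
        using bij uv in_arcsD1[OF xy(1)] in_arcsD2[OF xy(1)]
        by (auto simp: bij_betw_def dest: inj_onD)
      then show "(u, v) \<in> parcs G" using xy(1) by simp
    qed
    ultimately show ?R by blast
  next
    assume R: ?R
    define h where "h = \<lparr>iso_verts = f, iso_arcs = map_prod f f, iso_head = snd, iso_tail = fst\<rparr>"
    have inj: "inj_on f (pverts G)" and im: "f ` pverts G = pverts G"
      using R by (auto simp: bij_betw_def)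
    have "inj_on (map_prod f f) (parcs G)"
      using inj by (auto intro!: inj_onI) (meson in_arcsD1 in_arcsD2 inj_onD)+
    then have 1: "pre_digraph.digraph_isomorphism (with_proj G) h"
      using inj wf_digraph by (auto simp: pre_digraph.digraph_isomorphism_def h_def)
    have "map_prod f f ` parcs G = parcs G"
    proof (intro equalityI subsetI)
      fix e assume "e \<in> map_prod f f ` parcs G"
      then show "e \<in> parcs G" using R by (auto dest: in_arcsD1 in_arcsD2)
    next
      fix e assume e: "e \<in> parcs G"
      obtain x y where xy: "e = (x, y)" by (cases e)
      obtain u v where "u \<in> pverts G" "v \<in> pverts G" "x = f u" "y = f v"
        using e xy im in_arcsD1 in_arcsD2 by (metis imageE)
      then show "e \<in> map_prod f f ` parcs G" using R e xy by (auto intro!: rev_image_eqI)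
    qed
    then have "app_iso h (with_proj G) = with_proj G"
      using im by (intro pre_digraph.equality) (auto simp: h_def)
    with 1 show ?L by (auto simp: graph_automorphism_def h_def intro!: exI[of _ h])
  qed
qed

text \<open>Under the standing assumptions the graph is finite and simple.\<close>

lemma pair_graph_TC:
  assumes "even n" "1 \<le> k" "k < n div 2"
  shows "pair_graph (TC n k)"
proof -
  have ne: "(i + d) mod n \<noteq> i" "i \<noteq> (i + d) mod n" if "i < n" "0 < d" "d < n" for i d
    using that by (cases "i + d < n"; auto simp: mod_if)+
  have n: "1 < n" "0 < n div 2" "n div 2 < n" "0 < k" "k < n" using assms by auto
  interpret pair_digraph "TC_oriented n k"
    by unfold_locales
      (use n ne[OF _ _ n(1)] ne[OF _ n(2,3)] ne[OF _ n(4,5)] in \<open>auto simp: TC_oriented_def\<close>)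
  interpret T: pair_digraph "TC n k"
    unfolding TC_def by (rule digraph_mk_symmetric)
  show ?thesis
    by unfold_locales (unfold TC_def symmetric_def sym_def parcs_mk_symmetric with_proj_simps, blast)
qed

end

theory Submission
  imports Defs
begin

text \<open>
  In a vertex-transitive graph the number of closed walks of length \<open>r\<close> is the same at every vertex.
  A walk in \<open>TC n k\<close> changes the index by \<open>i + j k + e n/2\<close>, where \<open>i\<close> and \<open>j\<close> count the signed steps
  along the outer and the inner cycles and \<open>e\<close> is the parity of the number of diameters used. So the
  number of closed walks at \<open>a\<close>, \<open>b\<close> or \<open>c\<close> is a fixed combination of the truth values of the linear
  congruences \<open>i + j k + e n/2 = 0\<close> modulo \<open>n\<close>. Equating the three numbers for the lengths
  3, 4, 5, 6, 7, 8 in turn refutes all the congruences that could hold accidentally; at length 8 the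
  cycles \<open>a a b b a a b b\<close> and \<open>b b c c b b c c\<close>, which always exist, make \<open>b\<close> lie on more closed
  walks than \<open>a\<close> and \<open>c\<close>, and only \<open>n = 10\<close>, \<open>k = 3\<close> offers enough further 8-cycles to compensate.

  Conversely, in \<open>TC 10 3\<close> the reflections of the indices together with one involution that mixes
  the three layers act transitively.
\<close>

section \<open>Closed walks\<close>

text \<open>The \<open>r\<close>-th power of the adjacency operator applied to \<open>g\<close>,
  evaluated at \<open>v\<close>. On finite neighbourhoods it sums \<open>g\<close> over the ends of
  all walks of length \<open>r\<close> from \<open>v\<close>.\<close>

fun walk_sum :: "('v \<times> 'v) set \<Rightarrow> nat \<Rightarrow> 'v \<Rightarrow> ('v \<Rightarrow> int) \<Rightarrow> int" where
  "walk_sum E 0 v g = g v"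
| "walk_sum E (Suc r) v g = (\<Sum>u\<in>E `` {v}. walk_sum E r u g)"

text \<open>Peels off the last step instead of the first, to match \<open>walk_terms\<close>, where
  walks grow at their end.\<close>

lemma walk_sum_Suc_end:
  "walk_sum E (Suc r) v g = walk_sum E r v (\<lambda>u. \<Sum>x\<in>E `` {u}. g x)"
  by (induction r arbitrary: v) auto

text \<open>An automorphism maps the neighbours of \<open>v\<close> bijectively onto those of
  \<open>f v\<close>, so induction on \<open>r\<close> transports the sum.\<close>

lemma walk_sum_image:
  assumes f: "bij_betw f V V" and E: "E \<subseteq> V \<times> V"
    and adj: "\<And>u v. u \<in> V \<Longrightarrow> v \<in> V \<Longrightarrow> (f u, f v) \<in> E \<longleftrightarrow> (u, v) \<in> E"
    and v: "v \<in> V" and g: "\<And>u. u \<in> V \<Longrightarrow> g' (f u) = g u"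
  shows "walk_sum E r (f v) g' = walk_sum E r v g"
  using v
proof (induction r arbitrary: v)
  case (Suc r)
  have "E `` {f v} = f ` (E `` {v})"
  proof (intro equalityI subsetI)
    fix y assume y: "y \<in> E `` {f v}"
    then obtain u where "u \<in> V" "y = f u" using E f by (auto simp: bij_betw_def)
    then show "y \<in> f ` (E `` {v})" using y adj Suc.prems by blast
  qed (use E adj Suc.prems in auto)
  moreover have "inj_on f (E `` {v})"
    using f E by (auto simp: bij_betw_def intro: inj_on_subset)
  ultimately have "walk_sum E (Suc r) (f v) g' = (\<Sum>u\<in>E `` {v}. walk_sum E r (f u) g')"
    by (simp add: sum.reindex)
  also have "\<dots> = walk_sum E (Suc r) v g"
    using Suc.IH E by (auto intro!: sum.cong)
  finally show ?case .
qed (use g in simp)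

definition closed_walks :: "('v \<times> 'v) set \<Rightarrow> nat \<Rightarrow> 'v \<Rightarrow> int" where
  "closed_walks E r v = walk_sum E r v (\<lambda>u. of_bool (u = v))"

lemma closed_walks_vertex_transitive:
  assumes wf: "pair_wf_digraph G" and vt: "vertex_transitive (with_proj G)"
    and u: "u \<in> pverts G" and v: "v \<in> pverts G"
  shows "closed_walks (parcs G) r u = closed_walks (parcs G) r v"
proof -
  interpret pair_wf_digraph G by fact
  obtain h where h: "graph_automorphism (with_proj G) h" "iso_verts h u = v"
    using vt u v by (auto simp: vertex_transitive_def)
  define f where "f = iso_verts h"
  have f: "bij_betw f (pverts G) (pverts G)"
      "\<And>u v. u \<in> pverts G \<Longrightarrow> v \<in> pverts G \<Longrightarrow> (f u, f v) \<in> parcs G \<longleftrightarrow> (u, v) \<in> parcs G"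
    using graph_automorphism_with_proj_iff[OF wf, of f] h f_def by auto
  have sub: "parcs G \<subseteq> pverts G \<times> pverts G" by (auto dest: in_arcsD1 in_arcsD2)
  have "walk_sum (parcs G) r (f u) (\<lambda>w. of_bool (w = v)) =
      walk_sum (parcs G) r u (\<lambda>w. of_bool (w = u))"
    by (rule walk_sum_image[OF f(1) sub f(2) u])
      (use f(1) u h(2) in \<open>auto simp: f_def bij_betw_def dest: inj_onD\<close>)
  then show ?thesis
    using h(2) by (simp add: closed_walks_def f_def)
qed

section \<open>Walks in the generalized Tutte-Coxeter graphs\<close>

datatype layer = A | B | C

text \<open>
  \<open>(s, i, j, e)\<close> stands for the vertex of layer \<open>s\<close> whose index exceeds that of the start of the walk
  by \<open>i + j k + e n/2\<close>. Lists of such keys carry multiplicities, which are of type \<open>int\<close> because \<open>code_simp\<close>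
  computes with \<open>nat\<close> in unary.
\<close>

type_synonym walk_end = "layer \<times> int \<times> int \<times> bool"

fun steps :: "layer \<Rightarrow> walk_end list" where
  "steps A = [(A, 1, 0, False), (A, -1, 0, False), (B, 0, 0, False)]"
| "steps B = [(A, 0, 0, False), (B, 0, 0, True), (C, 0, 0, False)]"
| "steps C = [(B, 0, 0, False), (C, 0, 1, False), (C, 0, -1, False)]"

fun extend_walk :: "walk_end \<Rightarrow> walk_end list" where
  "extend_walk (s, i, j, e) = map (\<lambda>(s', i', j', e'). (s', i + i', j + j', e \<noteq> e')) (steps s)"

section \<open>Formal integer combinations of keys\<close>

fun add_term :: "'k \<Rightarrow> int \<Rightarrow> ('k \<times> int) list \<Rightarrow> ('k \<times> int) list" where
  "add_term x c [] = [(x, c)]"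
| "add_term x c ((y, d) # p) = (if x = y then (y, c + d) # p else (y, d) # add_term x c p)"

definition eval_terms :: "('k \<Rightarrow> int) \<Rightarrow> ('k \<times> int) list \<Rightarrow> int" where
  "eval_terms \<phi> p = (\<Sum>(x, c)\<leftarrow>p. c * \<phi> x)"

lemma eval_terms_simps [simp]:
  "eval_terms \<phi> [] = 0" "eval_terms \<phi> ((x, c) # p) = c * \<phi> x + eval_terms \<phi> p"
  by (auto simp: eval_terms_def)

lemma eval_terms_add_term [simp]: "eval_terms \<phi> (add_term x c p) = c * \<phi> x + eval_terms \<phi> p"
  by (induction p) (auto simp: algebra_simps)

text \<open>Linear extension of \<open>h\<close>. Merging equal keys keeps the lists short although
  there are 3^r walks of length r.\<close>

fun bind_terms :: "('k \<Rightarrow> 'l list) \<Rightarrow> ('k \<times> int) list \<Rightarrow> ('l \<times> int) list" where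
  "bind_terms h [] = []"
| "bind_terms h ((x, c) # p) = foldr (\<lambda>y. add_term y c) (h x) (bind_terms h p)"

lemma eval_terms_foldr_add_term:
  "eval_terms \<phi> (foldr (\<lambda>y. add_term y c) ys p) = c * (\<Sum>y\<leftarrow>ys. \<phi> y) + eval_terms \<phi> p"
  by (induction ys) (auto simp: algebra_simps)

lemma eval_terms_bind_terms:
  "eval_terms \<phi> (bind_terms h p) = eval_terms (\<lambda>x. \<Sum>y\<leftarrow>h x. \<phi> y) p"
  by (induction p) (auto simp: eval_terms_foldr_add_term)

fun walk_terms :: "layer \<Rightarrow> nat \<Rightarrow> (walk_end \<times> int) list" where
  "walk_terms t 0 = [((t, 0, 0, False), 1)]"
| "walk_terms t (Suc r) = bind_terms extend_walk (walk_terms t r)"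

text \<open>Reversing a closed walk negates \<open>(i, j)\<close>, so one of each pair of opposite keys suffices.\<close>

fun closing :: "layer \<Rightarrow> walk_end \<Rightarrow> (int \<times> int \<times> bool) list" where
  "closing t (s, i, j, e) =
     (if s \<noteq> t then [] else if i < 0 \<or> i = 0 \<and> j < 0 then [(-i, -j, e)] else [(i, j, e)])"

definition closed_terms :: "layer \<Rightarrow> nat \<Rightarrow> ((int \<times> int \<times> bool) \<times> int) list" where
  "closed_terms t r = bind_terms (closing t) (walk_terms t r)"

text \<open>Integer indices allow negative steps, and equality of vertices becomes divisibility by
  \<open>n\<close>.\<close>

definition vert :: "nat \<Rightarrow> layer \<Rightarrow> int \<Rightarrow> tc_vertex" where
  "vert n s z = (case s of A \<Rightarrow> Va | B \<Rightarrow> Vb | C \<Rightarrow> Vc) (nat (z mod int n))"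

lemma vert_eq_iff:
  assumes "n > 0"
  shows "vert n s z = vert n s' z' \<longleftrightarrow> s = s' \<and> int n dvd z - z'"
proof -
  have "nat (z mod int n) = nat (z' mod int n) \<longleftrightarrow> int n dvd z - z'"
    using assms by (simp add: eq_nat_nat_iff mod_eq_dvd_iff)
  then show ?thesis
    by (cases s; cases s') (auto simp: vert_def)
qed

lemma nat_mod_add: "nat ((int i + int d) mod int n) = (i + d) mod n"
  by (metis nat_int of_nat_add zmod_int)

lemma vert_mem_pverts:
  assumes "n > 0"
  shows "vert n s z \<in> pverts (TC n k)"
  using assms by (cases s) (auto simp: TC_def TC_oriented_def vert_def nat_less_iff)

text \<open>Letting \<open>z\<close> range over all integers repeats every arc periodically but
  keeps reductions modulo \<open>n\<close> out of the indices.\<close>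

definition oriented_arcs :: "nat \<Rightarrow> nat \<Rightarrow> int \<Rightarrow> (tc_vertex \<times> tc_vertex) set" where
  "oriented_arcs n k z =
     {(vert n A z, vert n A (z + 1)), (vert n A z, vert n B z),
      (vert n B z, vert n B (z + int (n div 2))), (vert n B z, vert n C z),
      (vert n C z, vert n C (z + int k))}"

lemma parcs_TC_oriented:
  assumes "n > 0"
  shows "parcs (TC_oriented n k) = (\<Union>z. oriented_arcs n k z)"
proof -
  have 1: "oriented_arcs n k (int i) =
      {(Va i, Va ((i + 1) mod n)), (Va i, Vb i), (Vb i, Vb ((i + n div 2) mod n)),
       (Vb i, Vc i), (Vc i, Vc ((i + k) mod n))}" if "i < n" for i
    using that nat_mod_add[of i 1 n] nat_mod_add[of i "n div 2" n] nat_mod_add[of i k n]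
    by (simp add: oriented_arcs_def vert_def add.commute)
  have 2: "oriented_arcs n k z = oriented_arcs n k (int (nat (z mod int n)))" for z
    using assms by (simp add: oriented_arcs_def vert_def mod_simps)
  have "(\<Union>z. oriented_arcs n k z) = (\<Union>i<n. oriented_arcs n k (int i))"
  proof (intro equalityI subsetI)
    fix x assume "x \<in> (\<Union>z. oriented_arcs n k z)"
    then obtain z where "x \<in> oriented_arcs n k z" by blast
    with 2[of z] have "x \<in> oriented_arcs n k (int (nat (z mod int n)))" by simp
    moreover have "nat (z mod int n) < n" using assms by (simp add: nat_less_iff)
    ultimately show "x \<in> (\<Union>i<n. oriented_arcs n k (int i))" by blast
  qed auto
  also have "\<dots> = parcs (TC_oriented n k)"
    using 1 by (simp add: TC_oriented_def)
  finally show ?thesis by simp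
qed

lemma parcs_TC:
  assumes "n > 0"
  shows "parcs (TC n k) = (\<Union>z. oriented_arcs n k z \<union> (oriented_arcs n k z)\<inverse>)"
  proof -
  have "parcs (TC n k) = parcs (TC_oriented n k) \<union> (parcs (TC_oriented n k))\<inverse>"
    by (auto simp: TC_def parcs_mk_symmetric)
  then show ?thesis
    using parcs_TC_oriented[OF assms] by auto
qed

fun shift :: "nat \<Rightarrow> nat \<Rightarrow> int \<times> int \<times> bool \<Rightarrow> int" where
  "shift n k (i, j, e) = i + j * int k + of_bool e * int (n div 2)"

lemma TC_neighbours:
  assumes n: "n > 0" "even n"
  shows "parcs (TC n k) `` {vert n s z} =
    set (map (\<lambda>(s', w). vert n s' (z + shift n k w)) (steps s))"
proof -
  have mem: "y \<in> parcs (TC n k) `` {x} \<longleftrightarrow>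
    (\<exists>w. (x, y) \<in> oriented_arcs n k w \<or> (y, x) \<in> oriented_arcs n k w)" for x y
    using n by (auto simp: parcs_TC)
  \<comment> \<open>Half a turn forwards and backwards agree modulo \<open>n\<close>, so the one
    diameter step in \<open>steps B\<close> covers both orientations.\<close>
  have half: "int n dvd w - (z - int (n div 2)) \<longleftrightarrow> int n dvd w - (z + int (n div 2))" for w
  proof -
    have "w - (z - int (n div 2)) = w - (z + int (n div 2)) + int n"
      using n(2) by auto
    then show ?thesis by (simp only: dvd_add_triv_right_iff)
  qed
  have flip: "int n dvd (w + d) - z \<longleftrightarrow> int n dvd w - (z - d)" for w d
    by (simp add: algebra_simps)
  show ?thesis
  proof (intro equalityI subsetI)
    fix y assume "y \<in> set (map (\<lambda>(s', w). vert n s' (z + shift n k w)) (steps s))"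
    \<comment> \<open>A backward step is an arc based at \<open>z - d\<close>: \<open>d\<close> is 0
      for spokes, 1 on the outer cycle and \<open>k\<close> on the inner cycles.\<close>
    then have "(vert n s z, y) \<in> oriented_arcs n k z \<or>
        (\<exists>d\<in>{0, 1, int k}. (y, vert n s z) \<in> oriented_arcs n k (z - d))"
      using n half by (cases s) (auto simp: oriented_arcs_def vert_eq_iff)
    then show "y \<in> parcs (TC n k) `` {vert n s z}"
      unfolding mem by blast
  next
    fix y assume "y \<in> parcs (TC n k) `` {vert n s z}"
    then obtain w where "(vert n s z, y) \<in> oriented_arcs n k w \<or> (y, vert n s z) \<in> oriented_arcs n k w"
      unfolding mem by blast
    then have "y \<in> set (map (\<lambda>(s', w). vert n s' (z + shift n k w)) (steps s))"
    proof
      assume "(vert n s z, y) \<in> oriented_arcs n k w"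
      then show ?thesis
        using n by (cases s) (auto simp: oriented_arcs_def vert_eq_iff dvd_diff_commute)
    next
      assume "(y, vert n s z) \<in> oriented_arcs n k w"
      then show ?thesis
        using n by (cases s) (auto simp: oriented_arcs_def vert_eq_iff dvd_diff_commute[of _ z] flip half)
    qed
    then show "y \<in> set (map (\<lambda>(s', w). vert n s' (z + shift n k w)) (steps s))" .
  qed
qed

text \<open>Opposite steps differ by 2 or by 2k, both strictly between 0 and \<open>n\<close>. Hence
  a sum over the neighbour set equals the sum over the list of steps.\<close>

lemma TC_steps_distinct:
  assumes "n \<ge> 3" "1 \<le> k" "k < n div 2"
  shows "distinct (map (\<lambda>(s', w). vert n s' (z + shift n k w)) (steps s))"
proof -
  have "\<not> int n dvd 2" "\<not> int n dvd 2 * int k"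
    using assms by (auto dest: zdvd_imp_le)
  then show ?thesis
    using assms by (cases s) (auto simp: vert_eq_iff algebra_simps)
qed

lemma walk_sum_TC:
  assumes "n \<ge> 3" "even n" "1 \<le> k" "k < n div 2"
  shows "walk_sum (parcs (TC n k)) r (vert n t z) g =
    eval_terms (\<lambda>(s, w). g (vert n s (z + shift n k w))) (walk_terms t r)"
proof (induction r arbitrary: g)
  case (Suc r)
  have half: "int n = 2 * int (n div 2)" using assms(2) by auto
  have "(\<Sum>x\<in>parcs (TC n k) `` {vert n s (z + shift n k w)}. g x) =
      (\<Sum>(s', w')\<leftarrow>extend_walk (s, w). g (vert n s' (z + shift n k w')))" for s w
  proof -
    obtain i j e where w: "w = (i, j, e)" by (metis surj_pair)
    \<comment> \<open>Shifts add only modulo \<open>n\<close>: two diameters contribute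
      \<open>n\<close>, which is why the parities combine by exclusive or.\<close>
    have add: "vert n s' (z + shift n k w + shift n k (i', j', e')) =
        vert n s' (z + shift n k (i + i', j + j', e \<noteq> e'))" for s' i' j' e'
      using assms w half by (simp add: vert_eq_iff algebra_simps)
    have "(\<Sum>x\<in>parcs (TC n k) `` {vert n s (z + shift n k w)}. g x) =
        (\<Sum>(s', w')\<leftarrow>steps s. g (vert n s' (z + shift n k w + shift n k w')))"
      using assms TC_steps_distinct[of n k "z + shift n k w" s]
      by (simp only: TC_neighbours sum.distinct_set_conv_list) (simp add: comp_def case_prod_unfold)
    then show ?thesis
      using add by (cases s) (simp_all add: w del: shift.simps)
  qed
  then show ?case
    by (simp only: walk_sum_Suc_end Suc.IH walk_terms.simps eval_terms_bind_terms)
      (simp add: case_prod_unfold)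
qed simp

lemma closed_walks_TC:
  assumes "n \<ge> 3" "even n" "1 \<le> k" "k < n div 2"
  shows "closed_walks (parcs (TC n k)) r (vert n t 0) =
    eval_terms (\<lambda>w. of_bool (int n dvd shift n k w)) (closed_terms t r)"
proof -
  have half: "int n = 2 * int (n div 2)" using assms(2) by auto
  \<comment> \<open>The flag \<open>e\<close> keeps its value under reversal, since n/2 and -n/2
    agree modulo \<open>n\<close>.\<close>
  have neg: "int n dvd shift n k (- i, - j, e) \<longleftrightarrow> int n dvd shift n k (i, j, e)" for i j e
  proof -
    have "shift n k (- i, - j, e) = of_bool e * int n - shift n k (i, j, e)"
      using half by (cases e) (simp_all add: algebra_simps)
    then show ?thesis by (simp add: dvd_diff_right_iff del: shift.simps)
  qed
  have "(\<Sum>w'\<leftarrow>closing t x. of_bool (int n dvd shift n k w')) =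
     (of_bool (vert n (fst x) (shift n k (snd x)) = vert n t 0) :: int)" for x
  proof -
    obtain s i j e where "x = (s, i, j, e)" by (metis surj_pair)
    then show ?thesis
      using assms neg[of i j e] by (auto simp del: shift.simps simp add: vert_eq_iff)
  qed
  then show ?thesis
    using assms
    by (simp add: closed_walks_def walk_sum_TC closed_terms_def eval_terms_bind_terms
      case_prod_unfold)
qed

section \<open>Closed walk counts for the lengths 3 to 8\<close>

lemma closed_terms_3:
  "closed_terms A 3 =
     [((3, 0, False), 2), ((1, 0, False), 10), ((0, 0, True), 1)]"
  "closed_terms C 3 =
     [((0, 0, True), 1), ((0, 3, False), 2), ((0, 1, False), 10)]"
  by code_simp+

lemma closed_terms_4:
  "closed_terms A 4 =
     [((4, 0, False), 2), ((2, 0, False), 14), ((1, 0, True), 4), ((0, 0, False), 15)]"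
  "closed_terms B 4 =
     [((0, 2, False), 2), ((0, 1, True), 4), ((1, 0, True), 4), ((0, 0, False), 15),
      ((2, 0, False), 2)]"
  "closed_terms C 4 =
     [((0, 4, False), 2), ((0, 2, False), 14), ((0, 0, False), 15), ((0, 1, True), 4)]"
  by code_simp+

lemma closed_terms_5:
  "closed_terms A 5 =
     [((5, 0, False), 2), ((3, 0, False), 18), ((1, 0, False), 58), ((2, 0, True), 6),
      ((0, 1, False), 2), ((0, 0, True), 11)]"
  "closed_terms C 5 =
     [((0, 0, True), 11), ((1, 0, False), 2), ((0, 2, True), 6), ((0, 5, False), 2),
      ((0, 3, False), 18), ((0, 1, False), 58)]"
  by code_simp+

lemma closed_terms_6:
  "closed_terms A 6 =
     [((0, 1, True), 4), ((0, 2, False), 2), ((6, 0, False), 2), ((4, 0, False), 22),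
      ((3, 0, True), 8), ((2, 0, False), 94), ((1, -1, False), 4), ((1, 1, False), 4),
      ((1, 0, True), 48), ((0, 0, False), 87)]"
  "closed_terms B 6 =
     [((0, 2, False), 24), ((0, 4, False), 2), ((0, 1, True), 44), ((0, 3, True), 4),
      ((1, 0, True), 44), ((1, -1, False), 4), ((1, 1, False), 4), ((0, 0, False), 87),
      ((3, 0, True), 4), ((4, 0, False), 2), ((2, 0, False), 24)]"
  "closed_terms C 6 =
     [((0, 6, False), 2), ((0, 4, False), 22), ((0, 2, False), 94), ((0, 3, True), 8),
      ((0, 0, False), 87), ((2, 0, False), 2), ((1, -1, False), 4), ((1, 1, False), 4),
      ((1, 0, True), 4), ((0, 1, True), 48)]"
  by code_simp+

lemma closed_terms_7:
  "closed_terms A 7 =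
     [((7, 0, False), 2), ((5, 0, False), 26), ((3, 0, False), 138), ((4, 0, True), 10),
      ((1, 0, False), 364), ((2, 1, False), 6), ((2, -1, False), 6), ((2, 0, True), 82),
      ((0, 2, True), 4), ((1, 2, False), 4), ((1, -2, False), 4), ((0, 3, False), 2),
      ((0, 1, False), 32), ((0, 0, True), 97), ((1, -1, True), 8), ((1, 1, True), 8)]"
  "closed_terms B 7 =
     [((5, 0, False), 2), ((3, 0, False), 28), ((1, 0, False), 164), ((1, -1, True), 12),
      ((1, 1, True), 12), ((0, 0, True), 185), ((4, 0, True), 4), ((2, 0, True), 54),
      ((2, -1, False), 4), ((2, 1, False), 4), ((0, 1, False), 164), ((0, 3, False), 28),
      ((0, 5, False), 2), ((0, 4, True), 4), ((1, 2, False), 4), ((1, -2, False), 4),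
      ((0, 2, True), 54)]"
  "closed_terms C 7 =
     [((2, 0, True), 4), ((0, 0, True), 97), ((1, 0, False), 32), ((3, 0, False), 2),
      ((0, 2, True), 82), ((1, 2, False), 6), ((1, -2, False), 6), ((0, 4, True), 10),
      ((0, 7, False), 2), ((0, 5, False), 26), ((0, 3, False), 138), ((0, 1, False), 364),
      ((2, -1, False), 4), ((1, -1, True), 8), ((2, 1, False), 4), ((1, 1, True), 8)]"
  by code_simp+

lemma closed_terms_8:
  "closed_terms A 8 =
     [((0, 3, True), 4), ((0, 1, True), 68), ((0, 4, False), 2), ((0, 2, False), 36),
      ((2, -1, True), 12), ((2, 1, True), 12), ((2, 2, False), 6), ((2, -2, False), 6),
      ((8, 0, False), 2), ((6, 0, False), 30), ((5, 0, True), 12), ((4, 0, False), 190),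
      ((3, -1, False), 8), ((3, 1, False), 8), ((3, 0, True), 124), ((2, 0, False), 644),
      ((1, -2, True), 8), ((1, -3, False), 4), ((1, -1, False), 68), ((1, 2, True), 8),
      ((1, 3, False), 4), ((1, 1, False), 68), ((1, 0, True), 444), ((0, 0, False), 547)]"
  "closed_terms B 8 =
     [((0, 2, False), 224), ((0, 4, False), 32), ((0, 6, False), 2), ((2, -1, True), 12),
      ((2, 1, True), 12), ((0, 1, True), 384), ((0, 3, True), 64), ((0, 5, True), 4),
      ((1, 2, True), 12), ((1, -2, True), 12), ((1, 0, True), 384), ((1, -1, False), 72),
      ((1, -3, False), 4), ((1, 1, False), 72), ((1, 3, False), 4), ((0, 0, False), 551),
      ((3, 0, True), 64), ((3, -1, False), 4), ((3, 1, False), 4), ((5, 0, True), 4),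
      ((6, 0, False), 2), ((4, 0, False), 32), ((2, 0, False), 224), ((2, 2, False), 4),
      ((2, -2, False), 4)]"
  "closed_terms C 8 =
     [((0, 8, False), 2), ((0, 6, False), 30), ((0, 4, False), 190), ((0, 5, True), 12),
      ((0, 2, False), 644), ((2, 2, False), 6), ((1, 3, False), 8), ((1, 2, True), 12),
      ((2, -2, False), 6), ((1, -3, False), 8), ((1, -2, True), 12), ((0, 3, True), 124),
      ((0, 0, False), 547), ((2, 0, False), 36), ((4, 0, False), 2), ((3, -1, False), 4),
      ((3, 1, False), 4), ((3, 0, True), 4), ((1, -1, False), 68), ((1, 1, False), 68),
      ((1, 0, True), 68), ((0, 1, True), 444), ((2, 1, True), 8), ((2, -1, True), 8)]"
  by code_simp+

section \<open>Comparison of the three layers\<close>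

lemma dvd_range_iff:
  fixes d x :: int
  assumes "- d < x" "x < 2 * d"
  shows "d dvd x \<longleftrightarrow> x = 0 \<or> x = d"
proof
  assume "d dvd x"
  then obtain q where q: "x = d * q" ..
  have "d > 0" using assms by linarith
  have "d * (- 1) < d * q" "d * q < d * 2"
    unfolding q[symmetric] using assms by simp_all
  then have "- 1 < q" "q < 2" using \<open>d > 0\<close> using mult_less_cancel_left_pos by blast+
  then have "q = 0 \<or> q = 1" by linarith
  then show "x = 0 \<or> x = d" using q by auto
qed auto

text \<open>Here \<open>m\<close> is n/2. Once size and parity have settled most congruences, each
  length leaves a small equation between truth values.\<close>

lemma closed_walk_numbers_agree:
  fixes m k :: int
  defines "N t r \<equiv>
    eval_terms (\<lambda>(i, j, e). of_bool (2 * m dvd i + j * k + of_bool e * m)) (closed_terms t r)"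
  assumes m: "2 \<le> m" and k: "1 \<le> k" "k < m"
    and eq: "\<And>r. N A r = N B r" "\<And>r. N A r = N C r"
  shows "m = 5 \<and> k = 3"
proof -
  define R where "R i j e \<longleftrightarrow> 2 * m dvd i + j * k + of_bool e * m" for i j e
  have N_eq: "N t r = eval_terms (\<lambda>(i, j, e). of_bool (R i j e)) (closed_terms t r)" for t r
    by (simp add: N_def R_def)
  note eqs = eq[unfolded N_eq]
  have R_iff: "R i j e \<longleftrightarrow> i + j * k + of_bool e * m = 0 \<or> i + j * k + of_bool e * m = 2 * m"
    if "- (2 * m) < i + j * k + of_bool e * m" "i + j * k + of_bool e * m < 4 * m" for i j e
    unfolding R_def using dvd_range_iff that by simp
  have odd_i: "\<not> R i j False" if "odd i" "even j" for i j
    unfolding R_def using that by (auto dest: dvd_mult_left)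
  \<comment> \<open>A multiple of \<open>m\<close> is either an even or an odd multiple; the odd
    ones become multiples of 2m after adding \<open>m\<close>.\<close>
  have R_double: "R 0 (2 * j) False \<longleftrightarrow> R 0 j False \<or> R 0 j True" for j
  proof -
    have "R 0 (2 * j) False \<longleftrightarrow> m dvd j * k"
      using m by (simp add: R_def mult.assoc)
    also have "\<dots> \<longleftrightarrow> R 0 j False \<or> R 0 j True"
    proof
      assume "m dvd j * k"
      then obtain q where q: "j * k = m * q" ..
      show "R 0 j False \<or> R 0 j True"
      proof (cases "even q")
        case False
        then have "even (q + 1)" by simp
        then have "2 * m dvd m * (q + 1)" by (elim evenE) simp
        then show ?thesis by (simp add: R_def q algebra_simps)
      qed (auto simp: R_def q elim!: evenE)
    next
      assume "R 0 j False \<or> R 0 j True"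
      then show "m dvd j * k"
        unfolding R_def by (auto dest: dvd_mult_right simp: dvd_add_left_iff)
    qed
    finally show ?thesis .
  qed

  have gen: "R 0 0 False" "\<not> R 0 0 True" "\<not> R 0 1 False" "\<not> R 0 1 True" "\<not> R 0 2 False"
      "\<not> R 1 0 True" "\<not> R 2 0 False" "\<not> R 1 1 False"
    using m k by (simp_all add: R_iff)
  have gen_odd: "\<not> R 1 0 False" "\<not> R 3 0 False" "\<not> R 5 0 False" "\<not> R 7 0 False"
      "\<not> R 1 2 False" "\<not> R 1 (-2) False"
    by (simp_all add: odd_i)
  note gen = gen gen_odd

  \<comment> \<open>By parity the count at a is 0, which forbids inner triangles.\<close>
  have 3: "\<not> R 0 3 False"
    using eqs(2)[of 3] gen by (simp add: closed_terms_3)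
  \<comment> \<open>Only the constant 15 remains at b, so the extra 4-cycles at a and at c are both
    impossible.\<close>
  have 4: "\<not> R 4 0 False" "\<not> R 0 4 False"
    using eqs[of 4] gen by (auto simp: closed_terms_4 of_bool_def split: if_splits)
  have "m \<noteq> 2" using 4(1) by (auto simp: R_def)
  with m have m3: "3 \<le> m" by simp
  \<comment> \<open>The first congruence would need \<open>m = 2\<close>; the second would imply
    \<open>R 0 4 False\<close> by doubling.\<close>
  have 5: "\<not> R 2 0 True" "\<not> R 0 2 True"
    using m3 4 R_double[of 2] by (simp_all add: R_iff)
  have 5: "\<not> R 2 0 True" "\<not> R 0 2 True" "\<not> R 0 5 False"
    using eqs(2)[of 5] gen 3 5 by (auto simp: closed_terms_5)
  have R6: "R 6 0 False \<longleftrightarrow> m = 3" "R 3 0 True \<longleftrightarrow> m = 3" "R 1 (-1) False \<longleftrightarrow> k = 1"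
      "R 0 6 False \<longleftrightarrow> R 0 3 True"
    using m3 k 3 R_double[of 3] by (auto simp: R_iff)
  \<comment> \<open>Apart from common terms the counts at a, b, c are 10x, 4x + 4y, 10y, where x and
    y are the truth values of \<open>m = 3\<close> and \<open>R 0 3 True\<close>; so x = y =
    0.\<close>
  have 6: "m \<noteq> 3" "\<not> R 0 3 True"
    using eqs[of 6] gen 3 4 5 R6 by (auto simp: closed_terms_6 of_bool_def split: if_splits)
  with m3 have m4: "4 \<le> m" by simp
  have R7: "R 4 0 True \<longleftrightarrow> m = 4" "R 1 1 True \<longleftrightarrow> k = m - 1" "\<not> R 1 (-1) True"
      "R 2 (-1) False \<longleftrightarrow> k = 2" "\<not> R 2 1 False"
    using m4 k by (auto simp: R_iff)
  \<comment> \<open>Comparing a with b at length 7 gives 6[m=4] + 2[k=2] = 4[k=m-1] + 4[R 0 4 True].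
    A nonzero solution would need \<open>m = 4\<close> and \<open>k = 2\<close>, but then 4k =
    2m.\<close>
  have "\<not> (m = 4 \<and> k = 2)" using 4 by (auto simp: R_def)
  then have 7: "m \<noteq> 4" "k \<noteq> m - 1" "k \<noteq> 2" "\<not> R 0 4 True"
    using eqs[of 7] gen 3 4 5 6 R6 R7
    by (auto simp: closed_terms_7 of_bool_def split: if_splits)
  with m4 have m5: "5 \<le> m" by simp
  have R8: "\<not> R 8 0 False" "R 5 0 True \<longleftrightarrow> m = 5" "R 3 (-1) False \<longleftrightarrow> k = 3" "\<not> R 3 1 False"
      "R 2 1 True \<longleftrightarrow> k = m - 2" "\<not> R 2 (-1) True" "R 2 (-2) False \<longleftrightarrow> k = 1" "\<not> R 2 2 False"
      "\<not> R 0 8 False" "R 1 2 True \<longleftrightarrow> 2 * k = m - 1" "R 1 (-2) True \<longleftrightarrow> 2 * k = m + 1"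
    using m5 k 7 4 R_double[of 4] by (auto simp: R_iff)
  \<comment> \<open>For \<open>k = 3\<close> the two congruences say that 2m divides 10 or 8; with
    \<open>5 \<le> m\<close> only 2m = 10 is possible.\<close>
  have three: "m = 5" if "k = 3" "R 1 3 False \<or> R 1 (-3) False"
    using that m5 by (auto simp: R_def dest: zdvd_imp_le)
  \<comment> \<open>Comparisons of a with b and of b with c, both halved. The constant 2 comes from
    551 - 547, the surplus at b.\<close>
  have 8: "2 * of_bool (k = 3) + 4 * of_bool (m = 5) = 2 + (2 * of_bool (R 0 5 True) + of_bool (k = 1) +
        2 * of_bool (2 * k = m - 1) + 2 * of_bool (2 * k = m + 1) :: int)"
      "2 + of_bool (k = 1) + 2 * of_bool (k = m - 2) + 2 * of_bool (m = 5) =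
        (4 * of_bool (R 0 5 True) + 2 * of_bool (R 1 3 False) + 2 * of_bool (R 1 (-3) False) :: int)"
    using eqs[of 8] gen 3 4 5 6 7 R6 R7 R8 by (simp_all add: closed_terms_8)
  \<comment> \<open>All other terms of the first equation are even.\<close>
  have "k \<noteq> 1"
    using 8(1) by (auto simp: of_bool_def split: if_splits)
  have "m = 5"
  proof (rule ccontr)
    assume "m \<noteq> 5"
    \<comment> \<open>Without \<open>m = 5\<close> the left side is at most 2, so it must exactly
      match the constant 2. The second equation then needs a congruence with coefficients 1 and 3 or
      -3.\<close>
    with 8(1) have "k = 3" "\<not> R 0 5 True" by (auto simp: of_bool_def split: if_splits)
    with 8(2) have "R 1 3 False \<or> R 1 (-3) False" by (auto simp: of_bool_def split: if_splits)
    with three \<open>k = 3\<close> \<open>m \<noteq> 5\<close> show False by blast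
  qed
  moreover have "k = 1 \<or> k = 2 \<or> k = 3 \<or> k = m - 1"
    using k \<open>m = 5\<close> by linarith
  ultimately show ?thesis
    using \<open>k \<noteq> 1\<close> 7 by blast
qed

section \<open>Vertex-transitivity of the Tutte-Coxeter graph\<close>

definition automorphic :: "'v pair_pre_digraph \<Rightarrow> ('v \<Rightarrow> 'v) \<Rightarrow> bool" where
  "automorphic G f \<longleftrightarrow> bij_betw f (pverts G) (pverts G) \<and>
     (\<forall>u\<in>pverts G. \<forall>v\<in>pverts G. (f u, f v) \<in> parcs G \<longleftrightarrow> (u, v) \<in> parcs G)"

lemma automorphic_comp:
  assumes f: "automorphic G f" and g: "automorphic G g"
  shows "automorphic G (g \<circ> f)"
proof -
  have "f v \<in> pverts G" if "v \<in> pverts G" for v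
    using f that by (auto simp: automorphic_def dest: bij_betw_apply)
  moreover have "bij_betw (g \<circ> f) (pverts G) (pverts G)"
    using f g by (auto simp: automorphic_def intro: bij_betw_trans)
  ultimately show ?thesis
    using f g by (simp add: automorphic_def)
qed

text \<open>Applying \<open>f\<close> a second time turns preservation of arcs into the converse
  implication.\<close>

lemma automorphic_involution:
  assumes inv: "\<And>v. v \<in> pverts G \<Longrightarrow> f v \<in> pverts G \<and> f (f v) = v"
    and arc: "\<And>u v. (u, v) \<in> parcs G \<Longrightarrow> (f u, f v) \<in> parcs G"
  shows "automorphic G f"
  unfolding automorphic_def
proof (intro conjI ballI iffI)
  show "bij_betw f (pverts G) (pverts G)"
    using inv by (intro bij_betw_byWitness[where f' = f]) auto
  show "(u, v) \<in> parcs G" if "u \<in> pverts G" "v \<in> pverts G" "(f u, f v) \<in> parcs G" for u v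
    using arc[OF that(3)] inv that(1,2) by simp
qed (rule arc)

text \<open>If \<open>f\<close> moves \<open>u\<close> to \<open>w\<close> and \<open>g\<close>
  moves \<open>v\<close> to \<open>w\<close>, then \<open>f\<close> followed by the inverse of
  \<open>g\<close> moves \<open>u\<close> to \<open>v\<close>.\<close>

lemma vertex_transitiveI:
  assumes wf: "pair_wf_digraph G" and w: "w \<in> pverts G"
    and ex: "\<And>v. v \<in> pverts G \<Longrightarrow> \<exists>f. automorphic G f \<and> f v = w"
  shows "vertex_transitive (with_proj G)"
  unfolding vertex_transitive_def
proof (intro ballI)
  fix u v assume "u \<in> verts (with_proj G)" "v \<in> verts (with_proj G)"
  then have uv: "u \<in> pverts G" "v \<in> pverts G" by simp_all
  obtain f where f: "automorphic G f" "f u = w" using ex[OF uv(1)] by blast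
  obtain g where g: "automorphic G g" "g v = w" using ex[OF uv(2)] by blast
  define g' where "g' = inv_into (pverts G) g"
  have bij: "bij_betw g (pverts G) (pverts G)" using g by (simp add: automorphic_def)
  have g': "bij_betw g' (pverts G) (pverts G)"
    unfolding g'_def by (rule bij_betw_inv_into[OF bij])
  have "automorphic G g'"
    unfolding automorphic_def
  proof (intro conjI ballI g')
    fix x y assume xy: "x \<in> pverts G" "y \<in> pverts G"
    then have "g' x \<in> pverts G" "g' y \<in> pverts G" "g (g' x) = x" "g (g' y) = y"
      using bij_betw_apply[OF g'] bij_betw_inv_into_right[OF bij] by (simp_all add: g'_def)
    then show "(g' x, g' y) \<in> parcs G \<longleftrightarrow> (x, y) \<in> parcs G"
      using g(1) unfolding automorphic_def by fastforce
  qed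
  then have "automorphic G (g' \<circ> f)" using f(1) automorphic_comp by blast
  then obtain h where h: "graph_automorphism (with_proj G) h"
      "\<And>x. x \<in> pverts G \<Longrightarrow> iso_verts h x = (g' \<circ> f) x"
    using graph_automorphism_with_proj_iff[OF wf, of "g' \<circ> f"]
    unfolding automorphic_def by blast
  have "(g' \<circ> f) u = v"
    using f(2) g(2) bij_betw_inv_into_left[OF bij uv(2)] by (simp add: g'_def)
  then show "\<exists>h. graph_automorphism (with_proj G) h \<and> iso_verts h u = v"
    using h uv(1) by metis
qed

lemma pair_wf_digraph_TC:
  assumes "even n" "1 \<le> k" "k < n div 2"
  shows "pair_wf_digraph (TC n k)"
proof -
  interpret pair_graph "TC n k" by (rule pair_graph_TC[OF assms])
  show ?thesis by (rule pair_wf_digraph_axioms)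
qed

lemma pverts_TC:
  assumes "n > 0"
  shows "pverts (TC n k) = (\<Union>t. range (vert n t))"
proof (intro equalityI subsetI)
  fix v assume "v \<in> pverts (TC n k)"
  then obtain i where "i < n" "v \<in> {Va i, Vb i, Vc i}"
    by (auto simp: TC_def TC_oriented_def)
  then have "v \<in> {vert n A (int i), vert n B (int i), vert n C (int i)}"
    by (simp add: vert_def)
  then show "v \<in> (\<Union>t. range (vert n t))" by auto
qed (use assms in \<open>auto simp: vert_mem_pverts\<close>)

text \<open>Reflections serve in place of rotations: they are involutions, and the one with
  \<open>s = z\<close> already takes index \<open>z\<close> to 0 in every layer.\<close>

fun reflection :: "nat \<Rightarrow> int \<Rightarrow> tc_vertex \<Rightarrow> tc_vertex" where
  "reflection n s (Va i) = vert n A (s - int i)"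
| "reflection n s (Vb i) = vert n B (s - int i)"
| "reflection n s (Vc i) = vert n C (s - int i)"

lemma reflection_vert:
  assumes "n > 0"
  shows "reflection n s (vert n t z) = vert n t (s - z)"
  using assms by (cases t) (simp_all add: vert_def mod_simps)

lemma automorphic_reflection:
  assumes "n > 0"
  shows "automorphic (TC n k) (reflection n s)"
proof (rule automorphic_involution)
  show "reflection n s v \<in> pverts (TC n k) \<and> reflection n s (reflection n s v) = v"
    if v: "v \<in> pverts (TC n k)" for v
  proof -
    obtain t z where "v = vert n t z" using v assms by (auto simp: pverts_TC)
    then show ?thesis using assms by (simp add: reflection_vert vert_mem_pverts)
  qed
next
  fix u v assume "(u, v) \<in> parcs (TC n k)"
  then obtain z where "(u, v) \<in> oriented_arcs n k z \<or> (v, u) \<in> oriented_arcs n k z"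
    unfolding parcs_TC[OF assms] by blast
  moreover have "\<exists>z'. (reflection n s y, reflection n s x) \<in> oriented_arcs n k z' \<or>
      (reflection n s x, reflection n s y) \<in> oriented_arcs n k z'"
    if "(x, y) \<in> oriented_arcs n k z" for x y
  proof -
    \<comment> \<open>A reflection reverses the direction of cycle edges and diameters, so the image
      arc is based at the reflected far end.\<close>
    have flip: "(reflection n s y, reflection n s x) \<in> oriented_arcs n k (s - (z + d))"
      if "x = vert n t z" "y = vert n t (z + d)"
        "(t, d) \<in> {(A, 1), (B, int (n div 2)), (C, int k)}" for t d
      using that assms by (auto simp: oriented_arcs_def reflection_vert)
    consider "x = vert n A z" "y = vert n A (z + 1)" | "x = vert n A z" "y = vert n B z"
      | "x = vert n B z" "y = vert n B (z + int (n div 2))" | "x = vert n B z" "y = vert n C z"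
      | "x = vert n C z" "y = vert n C (z + int k)"
      using \<open>(x, y) \<in> oriented_arcs n k z\<close> unfolding oriented_arcs_def by blast
    then show ?thesis
    proof cases
      case 1
      then show ?thesis using flip[of A 1] by blast
    next
      case 2
      then have "(reflection n s x, reflection n s y) \<in> oriented_arcs n k (s - z)"
        using assms by (simp add: oriented_arcs_def reflection_vert)
      then show ?thesis by blast
    next
      case 3
      then show ?thesis using flip[of B "int (n div 2)"] by blast
    next
      case 4
      then have "(reflection n s x, reflection n s y) \<in> oriented_arcs n k (s - z)"
        using assms by (simp add: oriented_arcs_def reflection_vert)
      then show ?thesis by blast
    next
      case 5
      then show ?thesis using flip[of C "int k"] by blast
    qed
  qed
  ultimately show "(reflection n s u, reflection n s v) \<in> parcs (TC n k)"
    unfolding parcs_TC[OF assms] by blast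
qed

text \<open>Found by computer search.\<close>

fun mixing :: "tc_vertex \<Rightarrow> tc_vertex" where
  "mixing (Va i) = [Va 0, Va 1, Va 2, Va 3, Va 4, Vb 4, Vc 4, Vc 7, Vc 0, Vb 0] ! i"
| "mixing (Vb i) = [Va 9, Vb 1, Vb 2, Vb 3, Va 5, Vb 9, Vc 1, Vb 7, Vc 3, Vb 5] ! i"
| "mixing (Vc i) = [Va 8, Vb 6, Vc 2, Vb 8, Va 6, Vc 9, Vc 8, Va 7, Vc 6, Vc 5] ! i"

text \<open>Explicit lists reduce the two checks on \<open>mixing\<close> to a finite
  enumeration.\<close>

lemma TC_oriented_10_3:
  "pverts (TC_oriented 10 3) = set (map Va [0..<10] @ map Vb [0..<10] @ map Vc [0..<10])"
  "parcs (TC_oriented 10 3) = set (concat (map (\<lambda>i.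
     [(Va i, Va ((i + 1) mod 10)), (Va i, Vb i), (Vb i, Vb ((i + 5) mod 10)),
      (Vb i, Vc i), (Vc i, Vc ((i + 3) mod 10))]) [0..<10]))"
  by (auto simp: TC_oriented_def)

lemma automorphic_mixing: "automorphic (TC 10 3) mixing"
proof (rule automorphic_involution)
  have "\<forall>v\<in>pverts (TC_oriented 10 3).
      mixing v \<in> pverts (TC_oriented 10 3) \<and> mixing (mixing v) = v"
    unfolding TC_oriented_10_3 by (simp add: upt_rec)
  then show "mixing v \<in> pverts (TC 10 3) \<and> mixing (mixing v) = v"
    if "v \<in> pverts (TC 10 3)" for v
    using that by (simp add: TC_def)
next
  \<comment> \<open>An image arc may run against the chosen orientation; the symmetric closure
    absorbs this.\<close>
  have "\<forall>(u, v)\<in>parcs (TC_oriented 10 3).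
      (mixing u, mixing v) \<in> parcs (TC_oriented 10 3) \<or>
      (mixing v, mixing u) \<in> parcs (TC_oriented 10 3)"
    unfolding TC_oriented_10_3 by (simp add: upt_rec)
  moreover have "parcs (TC 10 3) = parcs (TC_oriented 10 3) \<union> (parcs (TC_oriented 10 3))\<inverse>"
    by (auto simp: TC_def parcs_mk_symmetric)
  ultimately show "(mixing u, mixing v) \<in> parcs (TC 10 3)"
    if "(u, v) \<in> parcs (TC 10 3)" for u v
    using that by blast
qed

lemma vertex_transitive_TC_10_3: "vertex_transitive (TC 10 3)"
proof (rule vertex_transitiveI)
  show "pair_wf_digraph (TC 10 3)"
    by (rule pair_wf_digraph_TC) simp_all
  show "vert 10 A 0 \<in> pverts (TC 10 3)"
    by (simp add: vert_mem_pverts)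
  \<comment> \<open>These images explain the reflections about 9 and 8 below: index \<open>z\<close>
    goes to 0, \<open>mixing\<close> leads into layer A, and the last reflection returns to index
    0.\<close>
  have mix: "mixing (vert 10 B 0) = vert 10 A 9" "mixing (vert 10 C 0) = vert 10 A 8"
    by (simp_all add: vert_def)
  fix v assume "v \<in> pverts (TC 10 3)"
  then obtain t z where v: "v = vert 10 t z" by (auto simp: pverts_TC)
  note refl = automorphic_reflection[of 10 3]
  show "\<exists>f. automorphic (TC 10 3) f \<and> f v = vert 10 A 0"
  proof (cases t)
    case A
    then show ?thesis
      using v refl by (intro exI[of _ "reflection 10 z"]) (simp add: reflection_vert)
  next
    case B
    then show ?thesis
      using v refl automorphic_mixing
      by (intro exI[of _ "reflection 10 9 \<circ> (mixing \<circ> reflection 10 z)"])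
        (simp add: automorphic_comp reflection_vert mix)
  next
    case C
    then show ?thesis
      using v refl automorphic_mixing
      by (intro exI[of _ "reflection 10 8 \<circ> (mixing \<circ> reflection 10 z)"])
        (simp add: automorphic_comp reflection_vert mix)
  qed
qed

theorem theorem2p1:
  fixes n k :: nat
  assumes "n \<ge> 3" and "even n" and "1 \<le> k" and "k < n div 2"
  shows "vertex_transitive (TC n k) \<longleftrightarrow> (n, k) = (10, 3)"
proof
  assume vt: "vertex_transitive (TC n k)"
  have wf: "pair_wf_digraph (TC n k)"
    using assms by (simp add: pair_wf_digraph_TC)
  have n: "int n = 2 * int (n div 2)" using assms(2) by auto
  have agree: "eval_terms (\<lambda>w. of_bool (int n dvd shift n k w)) (closed_terms s r) =
      eval_terms (\<lambda>w. of_bool (int n dvd shift n k w)) (closed_terms t r)" for r s t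
    using assms closed_walks_vertex_transitive[OF wf vt, of "vert n s 0" "vert n t 0" r]
    by (simp add: closed_walks_TC vert_mem_pverts)
  have "(\<lambda>w. of_bool (int n dvd shift n k w)) = (\<lambda>(i, j, e).
      of_bool (2 * int (n div 2) dvd i + j * int k + of_bool e * int (n div 2)) :: int)"
    using n by (auto simp: fun_eq_iff)
  note agree' = agree[unfolded this]
  have "int (n div 2) = 5 \<and> int k = 3"
    by (rule closed_walk_numbers_agree) (use assms in linarith, use assms in linarith,
      use assms in linarith, rule agree', rule agree')
  then show "(n, k) = (10, 3)" using n by simp
next
  assume "(n, k) = (10, 3)"
  then have "n = 10" "k = 3" by simp_all
  then show "vertex_transitive (TC n k)"
    by (simp only: vertex_transitive_TC_10_3)
qed

end
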